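(* There exists an irregular Toeplitz sequence $\omega\in\{0,1\}^{\mathbb{Z}}$ such that the corresponding Toeplitz flow $(\Sigma_\omega,\sigma)$ satisfies $\sup_{n\in\mathbb{N}}\hat S_n(\sigma|_{\Sigma_\omega},\delta)<\infty$ for all $\delta>0$, and in particular $h_{\mathrm{mod}}(\sigma|_{\Sigma_\omega})=0$.
   Context: Let $\Sigma=\{0,1\}^{\mathbb{Z}}$ with the metric $d(\omega,\tilde\omega)=\sum_{k\in\mathbb{Z}:\,\omega_k\neq\tilde\omega_k}2^{-|k|}$, let $\sigma$ be the left shift on $\Sigma$, and for $\omega\in\Sigma$ let $\Sigma_\omega$ be the closure of the shift orbit $\{\sigma^k(\omega)\mid k\in\mathbb{Z}\}$. For $p\geq1$ let $\mathrm{Per}(\omega,p)=\{k\in\mathbb{Z}\mid\omega_{k+\ell p}=\omega_k\text{ for all }\ell\in\mathbb{Z}\}$ be the set of $p$-periodic positions, and let $\mathcal{D}(p)=\frac1p\#(\mathrm{Per}(\omega,p)\cap\{0,\ldots,p-1\})$ be its density. $\omega$ is a Toeplitz sequence if every $k\in\mathbb{Z}$ belongs to $\mathrm{Per}(\omega,p)$ for some $p\geq1$. A Toeplitz sequence is irregular if $\lim_{n\to\infty}\mathcal{D}(p_n)<1$ for a periodic structure $(p_n)_{n\in\mathbb{N}}$ of $\omega$, i.e. a sequence with $p_n\mid p_{n+1}$ and $\bigcup_n\mathrm{Per}(\omega,p_n)=\mathbb{Z}$; equivalently, if $\sup_{p\geq1}\mathcal{D}(p)<1$. For a continuous map $f:X\to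 X$ on a compact metric space $(X,d)$ and $n\ge1$, let $\hat d_n^f(x,y)=\frac1n\sum_{i=0}^{n-1}d(f^i(x),f^i(y))$, and let $\hat S_n(f,\delta)$ be the maximal cardinality of a set $S\subseteq X$ with $\hat d_n^f(x,y)\geq\delta$ for all $x\neq y$ in $S$. The modified power entropy is $h_{\mathrm{mod}}(f)=\lim_{\delta\to0}\lim_{n\to\infty}\frac{\log\hat S_n(f,\delta)}{\log n}$ (provided the limits as $n\to\infty$ exist). *)

theory Defs
  imports "HOL-Analysis.Analysis"
begin

section \<open>The full shift on two symbols\<close>

definition full_shift :: "(int \<Rightarrow> nat) set" where
  "full_shift = UNIV \<rightarrow> {0, 1}"

definition seq_dist :: "(int \<Rightarrow> nat) \<Rightarrow> (int \<Rightarrow> nat) \<Rightarrow> real" where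
  "seq_dist \<omega> \<omega>' = (\<Sum>\<^sub>\<infinity>k\<in>{k. \<omega> k \<noteq> \<omega>' k}. (1 / 2) ^ nat \<bar>k\<bar>)"

text \<open>The power \<open>shift_pow k\<close> of the left shift, for an arbitrary integer exponent.\<close>

definition shift_pow :: "int \<Rightarrow> (int \<Rightarrow> nat) \<Rightarrow> (int \<Rightarrow> nat)" where
  "shift_pow k \<omega> = (\<lambda>j. \<omega> (j + k))"

definition shift :: "(int \<Rightarrow> nat) \<Rightarrow> (int \<Rightarrow> nat)" where
  "shift \<omega> = (\<lambda>j. \<omega> (j + 1))"

lemma shift_pow_0: "shift_pow 0 = id"
  by (simp add: shift_pow_def fun_eq_iff)

lemma shift_pow_add: "shift_pow (k + l) = shift_pow k \<circ> shift_pow l"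
  by (simp add: shift_pow_def fun_eq_iff ac_simps)

lemma shift_pow_of_nat: "shift_pow (int n) = shift ^^ n"
proof (induction n)
  case (Suc n)
  have "shift_pow (int (Suc n)) = shift_pow 1 \<circ> shift_pow (int n)"
    unfolding shift_pow_add[symmetric] by simp
  also have "shift_pow 1 = shift"
    by (simp add: shift_pow_def shift_def fun_eq_iff)
  finally show ?case
    by (simp add: Suc.IH)
qed (simp add: shift_pow_0 id_def)

lemma summable_seq_dist: "(\<lambda>k::int. (1 / 2 :: real) ^ nat \<bar>k\<bar>) summable_on A"
proof (rule summable_on_subset_banach[OF _ subset_UNIV])
  have geo: "(\<lambda>n::nat. (1 / 2 :: real) ^ n) summable_on UNIV"
    by (intro norm_summable_imp_summable_on) (simp add: summable_geometric)
  have 1: "(\<lambda>k::int. (1 / 2 :: real) ^ nat \<bar>k\<bar>) summable_on range int"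
    using geo by (subst summable_on_reindex) (auto simp: o_def)
  have 2: "(\<lambda>k::int. (1 / 2 :: real) ^ nat \<bar>k\<bar>) summable_on range (\<lambda>n. - int n)"
    using geo by (subst summable_on_reindex) (auto simp: o_def inj_on_def)
  have "(\<lambda>k::int. (1 / 2 :: real) ^ nat \<bar>k\<bar>)
          summable_on (range int \<union> (range (\<lambda>n. - int n) - range int))"
    by (rule summable_on_Un_disjoint[OF 1 summable_on_subset_banach[OF 2]]) auto
  also have "range int \<union> (range (\<lambda>n. - int n) - range int) = UNIV"
    by (auto, metis int_cases2 rangeI)
  finally show "(\<lambda>k::int. (1 / 2 :: real) ^ nat \<bar>k\<bar>) summable_on UNIV" .
qed

lemma Metric_space_full_shift: "Metric_space full_shift seq_dist"
proof
  fix x y z :: "int \<Rightarrow> nat"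
  show nn: "0 \<le> seq_dist x y" for x y
    unfolding seq_dist_def by (rule infsum_nonneg) auto
  show "seq_dist x y = seq_dist y x"
    unfolding seq_dist_def by (simp add: eq_commute)
  show "seq_dist x y = 0 \<longleftrightarrow> x = y"
  proof
    assume 0: "seq_dist x y = 0"
    have "x k = y k" for k
    proof (rule ccontr)
      assume "x k \<noteq> y k"
      then have "infsum (\<lambda>k. (1 / 2 :: real) ^ nat \<bar>k\<bar>) {k} \<le> seq_dist x y"
        unfolding seq_dist_def
        by (intro infsum_mono_neutral summable_seq_dist) auto
      moreover have "(0 :: real) < (1 / 2) ^ nat \<bar>k\<bar>"
        by simp
      ultimately show False
        using 0 by (simp del: zero_less_power)
    qed
    then show "x = y" by auto
  qed (simp add: seq_dist_def)
  show "seq_dist x z \<le> seq_dist x y + seq_dist y z"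
  proof -
    let ?f = "\<lambda>k::int. (1 / 2 :: real) ^ nat \<bar>k\<bar>"
    let ?A = "{k. x k \<noteq> y k}" and ?B = "{k. y k \<noteq> z k}"
    have "seq_dist x z \<le> infsum ?f (?A \<union> (?B - ?A))"
      unfolding seq_dist_def by (intro infsum_mono_neutral summable_seq_dist) auto
    also have "\<dots> = infsum ?f ?A + infsum ?f (?B - ?A)"
      by (rule infsum_Un_disjoint) (auto intro: summable_seq_dist)
    also have "infsum ?f (?B - ?A) \<le> infsum ?f ?B"
      by (intro infsum_mono_neutral summable_seq_dist) auto
    finally show ?thesis
      by (simp add: seq_dist_def)
  qed
qed

definition orbit_closure :: "(int \<Rightarrow> nat) \<Rightarrow> (int \<Rightarrow> nat) set" where
  "orbit_closure \<omega> =
     Metric_space.mtopology full_shift seq_dist closure_of range (\<lambda>k. shift_pow k \<omega>)"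


section \<open>Toeplitz sequences\<close>

text \<open>
  Periods are required to be positive throughout: \<open>Per \<omega> 0\<close> is the set of all integers.
\<close>

definition Per :: "(int \<Rightarrow> nat) \<Rightarrow> nat \<Rightarrow> int set" where
  "Per \<omega> p = {k. \<forall>l::int. \<omega> (k + l * int p) = \<omega> k}"

definition Per_density :: "(int \<Rightarrow> nat) \<Rightarrow> nat \<Rightarrow> real" where
  "Per_density \<omega> p = real (card (Per \<omega> p \<inter> {0..<int p})) / real p"

definition toeplitz :: "(int \<Rightarrow> nat) \<Rightarrow> bool" where
  "toeplitz \<omega> \<longleftrightarrow> \<omega> \<in> full_shift \<and> (\<forall>k. \<exists>p\<ge>1. k \<in> Per \<omega> p)"

definition periodic_structure :: "(int \<Rightarrow> nat) \<Rightarrow> (nat \<Rightarrow> nat) \<Rightarrow> bool" where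
  "periodic_structure \<omega> p \<longleftrightarrow>
     (\<forall>n. p n \<ge> 1) \<and> (\<forall>n. p n dvd p (Suc n)) \<and> (\<Union>n. Per \<omega> (p n)) = UNIV"

definition irregular_toeplitz :: "(int \<Rightarrow> nat) \<Rightarrow> bool" where
  "irregular_toeplitz \<omega> \<longleftrightarrow> toeplitz \<omega> \<and>
     (\<exists>p L. periodic_structure \<omega> p \<and> (\<lambda>n. Per_density \<omega> (p n)) \<longlonglongrightarrow> L \<and> L < 1)"


section \<open>Modified power entropy\<close>

definition mean_dist ::
  "('a \<Rightarrow> 'a \<Rightarrow> real) \<Rightarrow> ('a \<Rightarrow> 'a) \<Rightarrow> nat \<Rightarrow> 'a \<Rightarrow> 'a \<Rightarrow> real" where
  "mean_dist d f n x y = (\<Sum>i<n. d ((f ^^ i) x) ((f ^^ i) y)) / real n"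

text \<open>
  The maximal cardinality of a \<open>\<delta>\<close>-separated subset of \<open>X\<close> is taken in the extended naturals.
  It suffices to range over finite sets: an infinite separated set has
  arbitrarily large finite subsets, so the supremum is then \<open>\<infinity>\<close>, and a finite supremum is attained.
\<close>

definition sep_number ::
  "'a set \<Rightarrow> ('a \<Rightarrow> 'a \<Rightarrow> real) \<Rightarrow> ('a \<Rightarrow> 'a) \<Rightarrow> nat \<Rightarrow> real \<Rightarrow> enat" where
  "sep_number X d f n \<delta> =
     (SUP S \<in> {S. S \<subseteq> X \<and> finite S \<and> (\<forall>x\<in>S. \<forall>y\<in>S. x \<noteq> y \<longrightarrow> mean_dist d f n x y \<ge> \<delta>)}.
        enat (card S))"

definition ln_enat :: "enat \<Rightarrow> ereal" where
  "ln_enat N = (case N of enat k \<Rightarrow> ereal (ln (real k)) | \<infinity> \<Rightarrow> \<infinity>)"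

text \<open>
  \<open>has_mod_power_entropy X d f h\<close> states that the limits defining the modified power entropy
  of \<open>f\<close> on \<open>X\<close> exist (for every \<open>\<delta> > 0\<close> as \<open>n\<close> tends to infinity) and that its value is \<open>h\<close>.
\<close>

definition has_mod_power_entropy ::
  "'a set \<Rightarrow> ('a \<Rightarrow> 'a \<Rightarrow> real) \<Rightarrow> ('a \<Rightarrow> 'a) \<Rightarrow> ereal \<Rightarrow> bool" where
  "has_mod_power_entropy X d f h \<longleftrightarrow>
     (\<exists>g :: real \<Rightarrow> ereal.
        (\<forall>\<delta>>0. (\<lambda>n. ln_enat (sep_number X d f n \<delta>) / ereal (ln (real n))) \<longlonglongrightarrow> g \<delta>) \<and>
        (g \<longlongrightarrow> h) (at_right 0))"

end

theory Submission
  imports Defs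
begin

text \<open>The witness is an Oxtoby sequence: its skeleton at stage \<open>n\<close> has period \<open>p\<^sub>n\<close>, and stage \<open>n\<close> fills
  only two of the \<open>p\<^bsub>n+1\<^esub> / p\<^sub>n\<close> blocks of length \<open>p\<^sub>n\<close>, with the constant symbol \<open>n mod 2\<close>. As
  \<open>\<Sum> 2 p\<^sub>n / p\<^bsub>n+1\<^esub> < 1\<close>, free positions of positive density remain at every stage, and since the
  symbols alternate, these are not \<open>p\<^sub>n\<close>-periodic. On the other hand, a window of length
  \<open>N \<in> [p\<^sub>m, p\<^bsub>m+1\<^esub>)\<close> starting at \<open>a\<close> is determined up to density \<open>\<epsilon>\<close> by \<open>a mod p\<^sub>k\<close>, with \<open>k\<close> depending
  only on \<open>\<epsilon>\<close>, and a function with at most three jumps: stages \<open>k, \<dots>, m - 1\<close> fill a set of small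
  density, and the symbols of stages \<open>\<ge> m\<close> are constant on long intervals. Up to \<open>\<epsilon>\<close> this leaves a
  number of windows bounded independently of \<open>N\<close>.\<close>

section \<open>Counting points of periodic sets\<close>

text \<open>Reduction modulo \<open>p\<close> maps any window of length \<open>p\<close> bijectively
  onto \<open>{0..<p}\<close> and preserves \<open>A\<close> by periodicity.\<close>

lemma periodic_card_period:
  fixes A :: "int set"
  assumes p: "p > 0" and per: "\<And>j l. j + l * p \<in> A \<longleftrightarrow> j \<in> A"
  shows "card (A \<inter> {a..<a + p}) = card (A \<inter> {0..<p})"
proof (rule bij_betw_same_card[of "\<lambda>j. j mod p"])
  have mod: "j mod p \<in> A \<longleftrightarrow> j \<in> A" for j
    using per[of j "- (j div p)"] by (simp add: minus_div_mult_eq_mod)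
  show "bij_betw (\<lambda>j. j mod p) (A \<inter> {a..<a + p}) (A \<inter> {0..<p})"
  proof (rule bij_betwI[where g = "\<lambda>j. a + (j - a) mod p"])
    show "(\<lambda>j. j mod p) \<in> A \<inter> {a..<a + p} \<rightarrow> A \<inter> {0..<p}"
      using p mod by auto
    have "a + (j - a) mod p \<in> A" if "j \<in> A" for j
      using per[of j "- ((j - a) div p)"] that
      by (simp add: algebra_simps minus_div_mult_eq_mod [symmetric])
    then show "(\<lambda>j. a + (j - a) mod p) \<in> A \<inter> {0..<p} \<rightarrow> A \<inter> {a..<a + p}"
      using p by auto
  qed (auto simp: mod_simps)
qed

lemma periodic_card_mult:
  fixes A :: "int set"
  assumes p: "p > 0" and per: "\<And>j l. j + l * p \<in> A \<longleftrightarrow> j \<in> A"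
  shows "card (A \<inter> {a..<a + int q * p}) = q * card (A \<inter> {0..<p})"
proof (induction q)
  case (Suc q)
  have "A \<inter> {a..<a + int (Suc q) * p} =
          (A \<inter> {a..<a + int q * p}) \<union> (A \<inter> {a + int q * p..<(a + int q * p) + p})"
    using p by (auto simp: algebra_simps) (smt (verit) mult_nonneg_nonneg of_nat_0_le_iff)+
  then have "card (A \<inter> {a..<a + int (Suc q) * p}) =
          card (A \<inter> {a..<a + int q * p}) + card (A \<inter> {a + int q * p..<(a + int q * p) + p})"
    by (simp only:) (subst card_Un_disjoint, auto)
  then show ?case
    by (simp add: Suc.IH periodic_card_period[OF p per])
qed simp

lemma periodic_card_le:
  fixes A :: "int set"
  assumes p: "p > 0" and per: "\<And>j l. j + l * int p \<in> A \<longleftrightarrow> j \<in> A"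
  shows "card (A \<inter> {a..<a + int N}) \<le> (N div p + 1) * card (A \<inter> {0..<int p})"
proof -
  have "N \<le> (N div p + 1) * p"
    using dividend_less_div_times[OF p, of N] by simp
  then have "int N \<le> int (N div p + 1) * int p"
    by (metis of_nat_le_iff of_nat_mult)
  then have "card (A \<inter> {a..<a + int N}) \<le> card (A \<inter> {a..<a + int (N div p + 1) * int p})"
    by (intro card_mono) auto
  then show ?thesis
    using periodic_card_mult[of "int p" A a "N div p + 1"] p per by simp
qed


section \<open>The sequence\<close>

text \<open>The exponent \<open>n + 4\<close> gives stage \<open>n\<close> density
  \<open>1 / 2 ^ (n + 3)\<close>. Even after doubling, which allows for incomplete periods, the
  densities from stage \<open>k\<close> on sum to at most \<open>1 / 2 ^ (k + 1)\<close>.\<close>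

primrec period :: "nat \<Rightarrow> nat" where
  "period 0 = 1"
| "period (Suc n) = 2 ^ (n + 4) * period n"

declare period.simps(2) [simp del]

lemma period_pos [simp]: "period n > 0"
  by (induction n) (auto simp: period.simps)

lemma period_Suc_ge: "8 * period n \<le> period (Suc n)"
  using one_le_power[of "2::nat" n] by (simp add: power_add period.simps)

lemma int_period_Suc_ge: "8 * int (period n) \<le> int (period (Suc n))"
  using period_Suc_ge[of n] by linarith

lemma period_dvd: "m \<le> n \<Longrightarrow> period m dvd period n"
  by (induction rule: dec_induct) (auto simp: period.simps)

lemma period_gt: "n < period n"
proof (induction n)
  case (Suc n)
  then show ?case
    using period_Suc_ge[of n] by linarith
qed simp

text \<open>Oxtoby's construction: in every interval \<open>[c p\<^bsub>n+1\<^esub>, (c + 1) p\<^bsub>n+1\<^esub>)\<close> stage \<open>n\<close> fills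
  the positions of the first and of the last block of length \<open>p\<^sub>n\<close> that are still free, all of them
  with the parity of \<open>n\<close>.\<close>

definition filled :: "nat \<Rightarrow> int set" where
  "filled n = {j. (j + int (period n)) mod int (period (Suc n)) < 2 * int (period n)}"

text \<open>Searching only from stage \<open>m\<close> on gives a function that jumps rarely and
  agrees with \<open>level 0\<close> wherever the earlier stages left the position free.\<close>

definition level :: "nat \<Rightarrow> int \<Rightarrow> nat" where
  "level m j = (LEAST i. m \<le> i \<and> j \<in> filled i)"

definition oxtoby :: "int \<Rightarrow> nat" where
  "oxtoby j = level 0 j mod 2"

section \<open>Periodicity and density of the filled positions\<close>

lemma filled_periodic:
  assumes "period (Suc n) dvd p"
  shows "j + l * int p \<in> filled n \<longleftrightarrow> j \<in> filled n"
proof -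
  obtain c where "p = period (Suc n) * c"
    using assms by blast
  then have eq: "j + l * int p + int (period n) = j + int (period n) + int (period (Suc n)) * (l * int c)"
    by (simp add: algebra_simps)
  show ?thesis
    by (simp only: filled_def mem_Collect_eq eq mod_mult_self2)
qed

lemma filled_cong:
  assumes "i < k" "a mod int (period k) = b mod int (period k)"
  shows "a \<in> filled i \<longleftrightarrow> b \<in> filled i"
proof -
  obtain l where "a - b = int (period k) * l"
    using assms(2) by (metis mod_eq_dvd_iff dvdE)
  then have "a = b + l * int (period k)"
    by (simp add: algebra_simps)
  then show ?thesis
    using filled_periodic[OF period_dvd[of "Suc i" k]] assms(1) by simp
qed

text \<open>The two blocks of a stage meet at 0, one on each side, so the sequence is eventually
  filled in both directions.\<close>

lemma filled_near_0:
  assumes "- int (period n) \<le> j" "j < int (period n)"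
  shows "j \<in> filled n"
  using assms int_period_Suc_ge[of n] by (simp add: filled_def)

lemma filled_card_period: "card (filled n \<inter> {0..<int (period (Suc n))}) \<le> 2 * period n"
proof -
  let ?p = "int (period n)" and ?P = "int (period (Suc n))"
  \<comment> \<open>Over the period starting at \<open>- ?p\<close> the two filled blocks are
    adjacent and form a single interval.\<close>
  have "filled n \<inter> {- ?p..<- ?p + ?P} \<subseteq> {- ?p..<?p}"
  proof
    fix j assume j: "j \<in> filled n \<inter> {- ?p..<- ?p + ?P}"
    then have "(j + ?p) mod ?P = j + ?p"
      by (intro mod_pos_pos_trivial) auto
    with j show "j \<in> {- ?p..<?p}"
      by (simp add: filled_def)
  qed
  then have "card (filled n \<inter> {- ?p..<- ?p + ?P}) \<le> card {- ?p..<?p}"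
    by (intro card_mono) auto
  moreover have "card (filled n \<inter> {- ?p..<- ?p + ?P}) = card (filled n \<inter> {0..<?P})"
    by (rule periodic_card_period) (use filled_periodic in auto)
  ultimately show ?thesis by simp
qed

lemma filled_card_le:
  assumes "period (Suc n) \<le> N"
  shows "real (card (filled n \<inter> {a..<a + int N})) \<le> real N / 2 ^ (n + 2)"
proof -
  let ?P = "period (Suc n)"
  have "card (filled n \<inter> {a..<a + int N}) \<le> (N div ?P + 1) * card (filled n \<inter> {0..<int ?P})"
    by (rule periodic_card_le) (use filled_periodic in auto)
  \<comment> \<open>As \<open>N\<close> is at least one full period, rounding up to complete periods
    costs at most a factor 2.\<close>
  also have "\<dots> \<le> (2 * (N div ?P)) * (2 * period n)"
    using assms filled_card_period[of n]
    by (intro mult_mono) (auto simp: Suc_le_eq div_greater_zero_iff )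
  finally have 1: "real (card (filled n \<inter> {a..<a + int N})) \<le> real ((2 * (N div ?P)) * (2 * period n))"
    by (simp only: of_nat_le_iff)
  have "real ((2 * (N div ?P)) * (2 * period n)) * 2 ^ (n + 2) = real (N div ?P * ?P)"
    by (simp add: power_add period.simps)
  also have "\<dots> \<le> real N"
    by (simp only: of_nat_le_iff div_times_less_eq_dividend)
  finally have "real (card (filled n \<inter> {a..<a + int N})) * 2 ^ (n + 2) \<le> real N"
    by (intro order_trans[OF mult_right_mono[OF 1]]) auto
  then show ?thesis
    by (subst pos_le_divide_eq) auto
qed

lemma filled_Union_card_le:
  assumes "period m \<le> N"
  shows "real (card ((\<Union>i\<in>{k..<m}. filled i) \<inter> {a..<a + int N})) \<le> real N / 2 ^ (k + 1)"
proof -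
  have le: "period (Suc i) \<le> N" if "i \<in> {k..<m}" for i
    using dvd_imp_le[OF period_dvd[of "Suc i" m] period_pos] that assms by simp
  have "card ((\<Union>i\<in>{k..<m}. filled i) \<inter> {a..<a + int N})
      \<le> (\<Sum>i\<in>{k..<m}. card (filled i \<inter> {a..<a + int N}))"
    unfolding Int_UN_distrib2 UN_simps(4)[symmetric] by (intro card_UN_le) auto
  then have "real (card ((\<Union>i\<in>{k..<m}. filled i) \<inter> {a..<a + int N}))
      \<le> (\<Sum>i\<in>{k..<m}. real (card (filled i \<inter> {a..<a + int N})))"
    by (simp flip: of_nat_sum)
  also have "\<dots> \<le> (\<Sum>i\<in>{k..<m}. real N / 2 ^ (i + 2))"
    by (intro sum_mono filled_card_le le)
  also have "\<dots> = real N * (\<Sum>i\<in>{k..<m}. 1 / 2 ^ (i + 2))"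
    by (simp add: sum_distrib_left)
  also have "(\<Sum>i\<in>{k..<m}. 1 / 2 ^ (i + 2) :: real) \<le> 1 / 2 ^ (k + 1)"
  proof (cases "k \<le> m")
    case True
    \<comment> \<open>Each term is written as a difference of consecutive powers, so that the sum
      telescopes.\<close>
    have "(\<Sum>i\<in>{k..<m}. 1 / 2 ^ (i + 2) :: real) =
        (\<Sum>i\<in>{k..<m}. - 1 / 2 ^ (Suc i + 1) - (- 1 / 2 ^ (i + 1)))"
      by (intro sum.cong) (simp_all add: power_add)
    also have "\<dots> = - 1 / 2 ^ (m + 1) - (- 1 / 2 ^ (k + 1))"
      using True by (rule sum_Suc_diff')
    finally show ?thesis by simp
  qed simp
  finally show ?thesis
    by (simp add: mult_left_mono)
qed

section \<open>The stage that fills a position\<close>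

lemma level_props: "m \<le> level m j" "j \<in> filled (level m j)"
proof -
  \<comment> \<open>Every stage \<open>n\<close> with \<open>n \<ge> \<bar>j\<bar>\<close> fills
    \<open>j\<close>, because \<open>period n > n\<close>; hence the minimum in \<open>level\<close>
    is attained.\<close>
  have "j \<in> filled (max m (nat \<bar>j\<bar>))"
    using period_gt[of "max m (nat \<bar>j\<bar>)"] by (intro filled_near_0) linarith+
  then have "m \<le> level m j \<and> j \<in> filled (level m j)"
    unfolding level_def using LeastI[of "\<lambda>i. m \<le> i \<and> j \<in> filled i" "max m (nat \<bar>j\<bar>)"] by simp
  then show "m \<le> level m j" "j \<in> filled (level m j)" by simp_all
qed

lemma level_eqI:
  "m \<le> i \<Longrightarrow> j \<in> filled i \<Longrightarrow> (\<And>i'. m \<le> i' \<Longrightarrow> i' < i \<Longrightarrow> j \<notin> filled i') \<Longrightarrow> level m j = i"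
  unfolding level_def by (rule Least_equality) (auto intro: leI)

lemma level_cong:
  "(\<And>i. m \<le> i \<Longrightarrow> a \<in> filled i \<longleftrightarrow> b \<in> filled i) \<Longrightarrow> level m a = level m b"
  unfolding level_def by (rule arg_cong[where f = Least]) auto

lemma level_0_eq: "(\<And>i. i < m \<Longrightarrow> j \<notin> filled i) \<Longrightarrow> level 0 j = level m j"
  unfolding level_def by (rule arg_cong[where f = Least]) (auto simp: not_less[symmetric] fun_eq_iff)

text \<open>The residue modulo \<open>period k\<close> decides membership in all stages below
  \<open>k\<close>, hence also which of them comes first, provided one of them fills
  \<open>a\<close>.\<close>

lemma level_0_periodic:
  assumes "a mod int (period k) = b mod int (period k)" "i < k" "a \<in> filled i"
  shows "level 0 a = level 0 b"
proof -
  have "level 0 a \<le> i"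
    unfolding level_def using assms(3) by (intro Least_le) auto
  then have "level 0 a < k"
    using assms(2) by simp
  moreover have "a \<notin> filled i'" if "i' < level 0 a" for i'
    using not_less_Least[of i' "\<lambda>i. 0 \<le> i \<and> a \<in> filled i"] that by (auto simp: level_def)
  ultimately show ?thesis
    using level_props(2)[of a 0] filled_cong[OF _ assms(1)]
    by (intro level_eqI[symmetric]) auto
qed

lemma oxtoby_periodic:
  assumes "a mod int (period k) = b mod int (period k)" "i < k" "a \<in> filled i"
  shows "oxtoby a = oxtoby b"
  using level_0_periodic[OF assms] by (simp add: oxtoby_def)


section \<open>Irregularity\<close>

lemma oxtoby_full_shift: "oxtoby \<in> full_shift"
  by (auto simp: full_shift_def oxtoby_def)

lemma filled_subset_Per: "filled i \<subseteq> Per oxtoby (period (Suc i))"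
proof
  fix j assume j: "j \<in> filled i"
  have "oxtoby (j + l * int (period (Suc i))) = oxtoby j" for l
    by (rule oxtoby_periodic[OF _ lessI j, symmetric]) simp
  then show "j \<in> Per oxtoby (period (Suc i))"
    by (simp add: Per_def)
qed

text \<open>A position left free by the first \<open>n\<close> stages receives the parity of \<open>n\<close> in the first block of
  length \<open>p\<^sub>n\<close> and the parity of \<open>n + 1\<close> in the second one.\<close>

lemma Per_oxtoby_subset: "Per oxtoby (period n) \<subseteq> (\<Union>i\<in>{0..<n}. filled i)"
proof (rule subsetI, rule ccontr)
  fix j assume j: "j \<in> Per oxtoby (period n)" and free: "j \<notin> (\<Union>i\<in>{0..<n}. filled i)"
  define j0 where "j0 = j mod int (period n)"
  have j0: "0 \<le> j0" "j0 < int (period n)" by (auto simp: j0_def)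
  have eq: "oxtoby (j0 + int (period n) * l) = oxtoby j" for l
  proof -
    have "j0 + int (period n) * l = j + (l - j div int (period n)) * int (period n)"
      unfolding j0_def by (simp add: minus_div_mult_eq_mod [symmetric] algebra_simps)
    then show ?thesis using j by (simp add: Per_def)
  qed
  have free': "j0 + int (period n) * l \<notin> filled i" if "i < n" for i l
    using free filled_cong[OF that, of j "j0 + int (period n) * l"] that by (auto simp: j0_def)
  have "level 0 j0 = n"
    using free'[of _ 0] filled_near_0[of n j0] j0 by (intro level_eqI) auto
  moreover have "level 0 (j0 + int (period n)) = Suc n"
  proof (intro level_eqI)
    show "j0 + int (period n) \<in> filled (Suc n)"
      using j0 int_period_Suc_ge[of n] by (intro filled_near_0) linarith+
    \<comment> \<open>Adding \<open>period n\<close> once more gives a value between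
      \<open>2 * period n\<close> and \<open>3 * period n\<close>, still below
      \<open>period (Suc n)\<close> and so outside the filled range.\<close>
    have "j0 + int (period n) \<notin> filled n"
      using j0 int_period_Suc_ge[of n] by (simp add: filled_def)
    then show "j0 + int (period n) \<notin> filled i" if "i < Suc n" for i
      using free'[of i 1] that by (cases "i = n") auto
  qed auto
  ultimately have "oxtoby j0 \<noteq> oxtoby (j0 + int (period n))"
    by (simp add: oxtoby_def) presburger
  then show False
    using eq[of 0] eq[of 1] by simp
qed

lemma Per_periodic: "j + l * int p \<in> Per \<omega> p \<longleftrightarrow> j \<in> Per \<omega> p"
proof -
  have *: "j + l * int p \<in> Per \<omega> p" if "j \<in> Per \<omega> p" for j l
    using that by (simp add: Per_def add.assoc flip: distrib_right)
  show ?thesis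
    using *[of j l] *[of "j + l * int p" "- l"] by auto
qed

text \<open>\<open>Per \<omega> p\<close> is contained in \<open>Per \<omega> q\<close> and has the
  same density over one period of length \<open>q\<close> as over one of length
  \<open>p\<close>.\<close>

lemma Per_density_dvd_mono:
  assumes "p dvd q" "p > 0" "q > 0"
  shows "Per_density \<omega> p \<le> Per_density \<omega> q"
proof -
  obtain c where q: "q = c * p" using assms(1) by (auto simp: dvd_def mult.commute)
  have "Per \<omega> p \<subseteq> Per \<omega> q"
  proof
    fix k assume k: "k \<in> Per \<omega> p"
    have "\<omega> (k + (l * int c) * int p) = \<omega> k" for l
      using k unfolding Per_def by blast
    then show "k \<in> Per \<omega> q" by (simp add: Per_def q mult.assoc)
  qed
  then have "card (Per \<omega> p \<inter> {0..<int q}) \<le> card (Per \<omega> q \<inter> {0..<int q})"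
    by (intro card_mono) auto
  moreover have "card (Per \<omega> p \<inter> {0..<int q}) = c * card (Per \<omega> p \<inter> {0..<int p})"
    using periodic_card_mult[of "int p" "Per \<omega> p" 0 c] Per_periodic[of _ _ p \<omega>] assms(2)
    by (simp add: q)
  ultimately have "real c * real (card (Per \<omega> p \<inter> {0..<int p})) \<le> real (card (Per \<omega> q \<inter> {0..<int q}))"
    by (metis of_nat_le_iff of_nat_mult)
  moreover have "c > 0" using q assms(3) by (cases c) auto
  ultimately show ?thesis
    using assms(2) by (simp add: Per_density_def q field_simps)
qed

lemma Per_density_oxtoby_le: "Per_density oxtoby (period n) \<le> 1 / 2"
proof -
  have "card (Per oxtoby (period n) \<inter> {0..<int (period n)})
      \<le> card ((\<Union>i\<in>{0..<n}. filled i) \<inter> {0..<int (period n)})"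
    using Per_oxtoby_subset[of n] by (intro card_mono) auto
  then have "real (card (Per oxtoby (period n) \<inter> {0..<int (period n)})) \<le> real (period n) / 2"
    using filled_Union_card_le[of n "period n" 0 0] by simp
  then show ?thesis
    by (simp add: Per_density_def field_simps)
qed

lemma irregular_toeplitz_oxtoby: "irregular_toeplitz oxtoby"
proof -
  have UN: "j \<in> Per oxtoby (period (Suc (level 0 j)))" for j
    by (rule subsetD[OF filled_subset_Per level_props(2)])
  have "toeplitz oxtoby"
    unfolding toeplitz_def
  proof (intro conjI allI oxtoby_full_shift)
    show "\<exists>p\<ge>1. j \<in> Per oxtoby p" for j
      using UN[of j] by (intro exI[of _ "period (Suc (level 0 j))"]) (simp add: Suc_leI)
  qed
  moreover have "periodic_structure oxtoby period"
    unfolding periodic_structure_def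
    using UN period_dvd[OF le_SucI[OF order_refl]] by (auto simp: Suc_leI)
  \<comment> \<open>Monotone and bounded by 1/2, the densities converge to a limit of at most
    1/2.\<close>
  moreover have "incseq (\<lambda>n. Per_density oxtoby (period n))"
    by (intro incseq_SucI Per_density_dvd_mono period_dvd period_pos) auto
  then obtain L where "(\<lambda>n. Per_density oxtoby (period n)) \<longlonglongrightarrow> L"
    using Per_density_oxtoby_le incseq_convergent[of "\<lambda>n. Per_density oxtoby (period n)" "1 / 2"] by blast
  moreover from this have "L \<le> 1 / 2"
    by (rule LIMSEQ_le_const2) (use Per_density_oxtoby_le in auto)
  ultimately show ?thesis
    unfolding irregular_toeplitz_def by (intro conjI exI[of _ period] exI[of _ L]) auto
qed


section \<open>Finitely many labels describe all windows\<close>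

text \<open>The jumps of \<^term>\<open>level m\<close>: the endpoints of the blocks filled at stage \<open>m\<close> and the multiples
  of \<open>p\<^bsub>m+1\<^esub>\<close>, since all later stages fill entire blocks of length \<open>p\<^bsub>m+1\<^esub>\<close>.\<close>

definition jumps :: "nat \<Rightarrow> int set" where
  "jumps m = {j. j mod int (period (Suc m)) \<in>
     {0, int (period m), int (period (Suc m)) - int (period m)}}"

text \<open>Membership in \<open>filled i\<close> can change only where
  \<open>r = (j + period i) mod period (Suc i)\<close> is 0 or \<open>2 * period i\<close>. For
  \<open>i = m\<close> such \<open>j\<close> are jumps; for \<open>i > m\<close> both values are
  multiples of \<open>period (Suc m)\<close>, and then so is \<open>j\<close>.\<close>

lemma filled_diff_1:
  assumes "j \<notin> jumps m" "m \<le> i"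
  shows "j \<in> filled i \<longleftrightarrow> j - 1 \<in> filled i"
proof -
  let ?p = "int (period i)" and ?P = "int (period (Suc i))"
  define r where "r = (j + ?p) mod ?P"
  have r: "0 \<le> r" "r < ?P" by (simp_all add: r_def)
  have P: "?P \<ge> 8 * ?p" "?p > 0"
    using int_period_Suc_ge[of i] by auto
  obtain q where q: "j = q * ?P + r - ?p"
    by (metis r_def add_diff_cancel_right' div_mult_mod_eq)
  have ne: "r \<noteq> 0 \<and> r \<noteq> 2 * ?p"
  proof (cases "i = m")
    case True
    have "j mod ?P = (r - ?p) mod ?P"
      unfolding q by (simp add: add_diff_eq[symmetric] del: add_diff_eq)
    moreover have "(0 - ?p) mod ?P = ?P - ?p"
      using P mod_pos_pos_trivial[of "?P - ?p" ?P] by simp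
    moreover have "?p mod ?P = ?p"
      by (rule mod_pos_pos_trivial) (use P in linarith)+
    then have "(2 * ?p - ?p) mod ?P = ?p"
      by simp
    ultimately show ?thesis
      using assms(1) True unfolding jumps_def by fastforce
  next
    case False
    then have dvd: "int (period (Suc m)) dvd ?p"
      using assms(2) period_dvd[of "Suc m" i] by simp
    moreover have "?p dvd ?P"
      using period_dvd[of i "Suc i"] by simp
    ultimately have "int (period (Suc m)) dvd q * ?P"
      by (intro dvd_mult) (rule dvd_trans)
    then have "int (period (Suc m)) dvd j" if "int (period (Suc m)) dvd r"
      unfolding q by (intro dvd_add dvd_diff that dvd)
    moreover have "\<not> int (period (Suc m)) dvd j"
      using assms(1) by (simp add: jumps_def mod_eq_0_iff_dvd)
    ultimately show ?thesis
      using dvd by (metis dvd_0_right dvd_mult)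
  qed
  have "(j - 1 + ?p) mod ?P = (r - 1) mod ?P"
    unfolding r_def by (simp add: mod_simps algebra_simps)
  also have "\<dots> = r - 1"
    using r ne by simp
  finally show ?thesis
    using ne by (auto simp: filled_def r_def)
qed

lemma level_diff_1: "j \<notin> jumps m \<Longrightarrow> level m j = level m (j - 1)"
  by (rule level_cong) (rule filled_diff_1)

text \<open>A window shorter than \<open>period (Suc m)\<close> fits into one period, which contains
  at most three jumps.\<close>

lemma jumps_card_le:
  assumes "N < period (Suc m)"
  shows "card (jumps m \<inter> {a..<a + int N}) \<le> 3"
proof -
  let ?p = "int (period m)" and ?P = "int (period (Suc m))"
  have "jumps m \<inter> {0..<?P} \<subseteq> {0, ?p, ?P - ?p}"
  proof
    fix j assume j: "j \<in> jumps m \<inter> {0..<?P}"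
    then have "j mod ?P = j"
      by (intro mod_pos_pos_trivial) auto
    with j show "j \<in> {0, ?p, ?P - ?p}"
      unfolding jumps_def by (simp only: Int_iff mem_Collect_eq)
  qed
  then have "card (jumps m \<inter> {0..<?P}) \<le> card {0, ?p, ?P - ?p}"
    by (intro card_mono) auto
  also have "\<dots> \<le> 3"
    by (simp add: card_insert_if)
  finally have "card (jumps m \<inter> {0..<?P}) \<le> 3" .
  moreover have "card (jumps m \<inter> {a..<a + int N}) \<le> (N div period (Suc m) + 1) * card (jumps m \<inter> {0..<?P})"
    by (rule periodic_card_le) (auto simp: jumps_def)
  ultimately show ?thesis
    using assms by simp
qed

lemma card_translate_le:
  "card {t. t < N \<and> a + int t \<in> A} \<le> card (A \<inter> {a..<a + int N})"
  by (rule card_inj_on_le[of "\<lambda>t. a + int t"]) (auto simp: inj_on_def)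

text \<open>If \<open>g\<close> at \<open>t\<close> differs from its value at the start of the cell
  of \<open>t\<close>, some point \<open>u\<close> of \<open>D\<close> lies between them, and
  \<open>t < u + s\<close>. So each point of \<open>D\<close> accounts for at most \<open>s\<close>
  bad positions.\<close>

lemma card_cells_le:
  fixes g :: "nat \<Rightarrow> 'a"
  assumes s: "s > 0" and g: "\<And>t. 0 < t \<Longrightarrow> t \<notin> D \<Longrightarrow> g t = g (t - 1)"
  shows "card {t. t < N \<and> g t \<noteq> g (t div s * s)} \<le> s * card {t. t < N \<and> t \<in> D}"
proof -
  have "{t. t < N \<and> g t \<noteq> g (t div s * s)} \<subseteq> (\<Union>u\<in>{t. t < N \<and> t \<in> D}. {u..<u + s})"
  proof
    fix t assume t: "t \<in> {t. t < N \<and> g t \<noteq> g (t div s * s)}"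
    have "\<exists>u\<in>D. t div s * s < u \<and> u \<le> t"
    proof (rule ccontr)
      assume no: "\<not> (\<exists>u\<in>D. t div s * s < u \<and> u \<le> t)"
      have "v \<le> t \<longrightarrow> g v = g (t div s * s)" if "t div s * s \<le> v" for v
        using that
      proof (induction rule: dec_induct)
        case (step n)
        then show ?case
          using g[of "Suc n"] no by fastforce
      qed simp
      from this[of t] show False using t by simp
    qed
    then obtain u where u: "u \<in> D" "t div s * s < u" "u \<le> t" by blast
    have "t < t div s * s + s"
      using dividend_less_div_times[OF s, of t] by simp
    then show "t \<in> (\<Union>u\<in>{t. t < N \<and> t \<in> D}. {u..<u + s})"
      using u t by (intro UN_I[of u]) auto
  qed
  then have "card {t. t < N \<and> g t \<noteq> g (t div s * s)} \<le> card (\<Union>u\<in>{t. t < N \<and> t \<in> D}. {u..<u + s})"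
    by (intro card_mono) auto
  also have "\<dots> \<le> (\<Sum>u\<in>{t. t < N \<and> t \<in> D}. card {u..<u + s})"
    by (intro card_UN_le) auto
  finally show ?thesis by (simp add: mult.commute)
qed

text \<open>The label of a window \<open>[a, a + N)\<close> with \<open>p\<^sub>m \<le> N < p\<^bsub>m+1\<^esub>\<close> is the residue of \<open>a\<close> modulo \<open>p\<^sub>k\<close>
  together with samples of \<open>level m\<close> at boundedly many places. Windows with the same label can differ
  only at positions filled in the stages \<open>k, \<dots>, m - 1\<close>, which are rare, and in the few cells of the
  sampling grid that contain a jump. Windows that are too short for this have their entire content as
  label.\<close>

lemma oxtoby_labels_bound:
  assumes "period m \<le> N" "N < period (Suc m)" "s > 0"
    and mod: "a mod int (period k) = b mod int (period k)"
    and samples: "\<And>t. t < N \<Longrightarrow>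
      level m (a + int (t div s * s)) mod 2 = level m (b + int (t div s * s)) mod 2"
  shows "real (card {t. t < N \<and> oxtoby (a + int t) \<noteq> oxtoby (b + int t)}) \<le> real N / 2 ^ k + 6 * real s"
proof -
  \<comment> \<open>For \<open>m \<le> k\<close> this is empty, and the residue modulo
    \<open>period k\<close> controls all stages below \<open>m\<close>.\<close>
  define B where "B = (\<Union>i\<in>{k..<m}. filled i)"
  define X where "X c = {t. t < N \<and> c + int t \<in> B}" for c
  define Y where "Y c = {t. t < N \<and> level m (c + int t) \<noteq> level m (c + int (t div s * s))}" for c
  have sub: "{t. t < N \<and> oxtoby (a + int t) \<noteq> oxtoby (b + int t)} \<subseteq> (X a \<union> X b) \<union> (Y a \<union> Y b)"
  proof (rule subsetI, rule ccontr)
    fix t assume t: "t \<in> {t. t < N \<and> oxtoby (a + int t) \<noteq> oxtoby (b + int t)}"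
      and no: "t \<notin> (X a \<union> X b) \<union> (Y a \<union> Y b)"
    have mod': "(a + int t) mod int (period k) = (b + int t) mod int (period k)"
      using mod by (rule mod_add_cong) simp
    \<comment> \<open>If either position were filled before stage \<open>k\<close>, the equal
      residues would force equal symbols.\<close>
    have low: "a + int t \<notin> filled i" "b + int t \<notin> filled i" if "i < k" for i
      using oxtoby_periodic[OF mod' that] oxtoby_periodic[OF mod'[symmetric] that] t by auto
    have mid: "a + int t \<notin> filled i" "b + int t \<notin> filled i" if "k \<le> i" "i < m" for i
      using no t that by (auto simp: X_def B_def)
    have "level 0 (a + int t) = level m (a + int t)" "level 0 (b + int t) = level m (b + int t)"
      by (intro level_0_eq; metis low mid not_less)+
    moreover have "level m (a + int t) mod 2 = level m (b + int t) mod 2"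
      using no t samples[of t] by (auto simp: Y_def)
    ultimately show False
      using t by (auto simp: oxtoby_def)
  qed
  have X: "real (card (X c)) \<le> real N / 2 ^ (k + 1)" for c
  proof -
    have "card (X c) \<le> card (B \<inter> {c..<c + int N})"
      unfolding X_def by (rule card_translate_le)
    then show ?thesis
      unfolding B_def using filled_Union_card_le[OF assms(1), of k c] by linarith
  qed
  \<comment> \<open>Each of at most three jumps spoils at most \<open>s\<close> positions; the two
    windows together give the term \<open>6 * real s\<close>.\<close>
  have Y: "card (Y c) \<le> s * 3" for c
  proof -
    have "card (Y c) \<le> s * card {t. t < N \<and> t \<in> {t. c + int t \<in> jumps m}}"
      unfolding Y_def
    proof (rule card_cells_le[OF assms(3)])
      fix t :: nat assume "0 < t" "t \<notin> {t. c + int t \<in> jumps m}"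
      then show "level m (c + int t) = level m (c + int (t - 1))"
        using level_diff_1[of "c + int t" m] by (simp add: of_nat_diff algebra_simps)
    qed
    also have "card {t. t < N \<and> t \<in> {t. c + int t \<in> jumps m}} \<le> 3"
      using card_translate_le[of N c "jumps m"] jumps_card_le[OF assms(2), of c] by simp
    finally show ?thesis by simp
  qed
  have fin: "finite (X c)" "finite (Y c)" for c by (simp_all add: X_def Y_def)
  have "card {t. t < N \<and> oxtoby (a + int t) \<noteq> oxtoby (b + int t)} \<le> card ((X a \<union> X b) \<union> (Y a \<union> Y b))"
    by (intro card_mono sub) (simp add: fin)
  also have "\<dots> \<le> (card (X a) + card (X b)) + (card (Y a) + card (Y b))"
    by (intro order_trans[OF card_Un_le] add_mono card_Un_le)
  finally have "real (card {t. t < N \<and> oxtoby (a + int t) \<noteq> oxtoby (b + int t)})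
      \<le> (real (card (X a)) + real (card (X b))) + (real (card (Y a)) + real (card (Y b)))"
    by linarith
  moreover have "real (card (Y c)) \<le> real s * 3" for c
    using Y[of c] by (metis of_nat_le_iff of_nat_mult of_nat_numeral)
  moreover have "real N / 2 ^ (k + 1) + real N / 2 ^ (k + 1) = real N / 2 ^ k"
    by simp
  ultimately show ?thesis
    using X[of a] X[of b] by (smt (verit))
qed

lemma period_window:
  assumes "N \<ge> 1"
  obtains m where "period m \<le> N" "N < period (Suc m)"
proof -
  define m where "m = (LEAST m. N < period (Suc m))"
  have "N < period (Suc N)" using period_gt[of "Suc N"] by simp
  then have less: "N < period (Suc m)" unfolding m_def by (rule LeastI)
  have "period m \<le> N"
  proof (cases m)
    case (Suc m')
    then show ?thesis
      using not_less_Least[of m' "\<lambda>m. N < period (Suc m)"] by (simp add: m_def not_less)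
  qed (use assms in simp)
  then show thesis using less that by blast
qed

text \<open>The label set \<open>L\<close> depends on \<open>\<epsilon>\<close> but not on
  \<open>N\<close>; this uniformity is what bounds the separation numbers.\<close>

lemma oxtoby_finite_labels:
  assumes "\<epsilon> > 0"
  shows "\<exists>L :: (int \<times> nat list) set. finite L \<and> (\<forall>N\<ge>1. \<exists>\<Phi>. range \<Phi> \<subseteq> L \<and>
    (\<forall>a b. \<Phi> a = \<Phi> b \<longrightarrow>
      real (card {t. t < N \<and> oxtoby (a + int t) \<noteq> oxtoby (b + int t)}) \<le> \<epsilon> * real N))"
proof -
  \<comment> \<open>One half of \<open>\<epsilon>\<close> pays for the positions filled in the
    middle stages, the other for the cells containing jumps.\<close>
  obtain k where "(1 / 2) ^ k < \<epsilon> / 2"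
    using real_arch_pow_inv[of "\<epsilon> / 2" "1 / 2"] assms by auto
  then have k: "2 / 2 ^ k \<le> \<epsilon>"
    by (simp add: power_divide)
  define R where "R = 12 * 2 ^ k * period k"
  have R: "R > 0" by (simp add: R_def)
  have kR: "12 * 2 ^ k \<le> R"
    by (simp add: R_def Suc_leI)
  define L where "L = {0..<int (period k)} \<times> {xs. set xs \<subseteq> {0, 1 :: nat} \<and> length xs = R}"
  have "finite L"
    unfolding L_def by (intro finite_cartesian_product finite_lists_length_eq) auto
  moreover have "\<exists>\<Phi>. range \<Phi> \<subseteq> L \<and> (\<forall>a b. \<Phi> a = \<Phi> b \<longrightarrow>
      real (card {t. t < N \<and> oxtoby (a + int t) \<noteq> oxtoby (b + int t)}) \<le> \<epsilon> * real N)"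
    if N: "N \<ge> 1" for N
  proof (cases "N \<le> R")
    case True
    define \<Phi> where "\<Phi> a = (a mod int (period k), map (\<lambda>t. oxtoby (a + int t)) [0..<R])" for a
    have "range \<Phi> \<subseteq> L"
      by (auto simp: \<Phi>_def L_def oxtoby_def)
    moreover have "real (card {t. t < N \<and> oxtoby (a + int t) \<noteq> oxtoby (b + int t)}) \<le> \<epsilon> * real N"
      if "\<Phi> a = \<Phi> b" for a b
    proof -
      have "{t. t < N \<and> oxtoby (a + int t) \<noteq> oxtoby (b + int t)} = {}"
        using that True by (auto simp: \<Phi>_def)
      then show ?thesis
        using assms by (simp only: card.empty) simp
    qed
    ultimately show ?thesis by blast
  next
    case False
    obtain m where m: "period m \<le> N" "N < period (Suc m)"
      using period_window[OF N] .
    \<comment> \<open>Then \<open>R\<close> cells of length \<open>s\<close> cover the window, while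
      \<open>N > R\<close> gives \<open>s * R \<le> 2 * N\<close>; with
      \<open>R \<ge> 12 * 2 ^ k\<close> this yields \<open>6 * s \<le> N / 2 ^ k\<close>.\<close>
    define s where "s = N div R + 1"
    define \<Phi> where
      "\<Phi> a = (a mod int (period k), map (\<lambda>r. level m (a + int (r * s)) mod 2) [0..<R])" for a
    have cell: "t div s < R" if "t < N" for t
    proof -
      have "N < R * s"
        using dividend_less_div_times[OF R, of N] by (simp add: s_def algebra_simps)
      then show ?thesis
        using that by (simp add: less_mult_imp_div_less)
    qed
    have "s * R = R + N div R * R"
      by (simp add: s_def)
    then have "s * R \<le> 2 * N"
      using False div_times_less_eq_dividend[of N R] by linarith
    then have "s * (12 * 2 ^ k) \<le> 2 * N"
      using mult_le_mono2[OF kR, of s] by linarith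
    then have "real (s * (12 * 2 ^ k)) \<le> real (2 * N)"
      by (simp only: of_nat_le_iff)
    then have s: "6 * real s \<le> real N / 2 ^ k"
      by (simp add: field_simps)
    have "range \<Phi> \<subseteq> L"
      by (auto simp: \<Phi>_def L_def)
    moreover have "real (card {t. t < N \<and> oxtoby (a + int t) \<noteq> oxtoby (b + int t)}) \<le> \<epsilon> * real N"
      if "\<Phi> a = \<Phi> b" for a b
    proof -
      have "real (card {t. t < N \<and> oxtoby (a + int t) \<noteq> oxtoby (b + int t)}) \<le> real N / 2 ^ k + 6 * real s"
      proof (rule oxtoby_labels_bound[OF m])
        show "a mod int (period k) = b mod int (period k)" "s > 0"
          using that by (auto simp: \<Phi>_def s_def)
        show "level m (a + int (t div s * s)) mod 2 = level m (b + int (t div s * s)) mod 2" if "t < N" for t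
          using \<open>\<Phi> a = \<Phi> b\<close> cell[OF that] by (auto simp: \<Phi>_def)
      qed
      also have "\<dots> \<le> 2 / 2 ^ k * real N"
        using s by simp
      also have "\<dots> \<le> \<epsilon> * real N"
        by (intro mult_right_mono k) simp
      finally show ?thesis .
    qed
    ultimately show ?thesis by blast
  qed
  ultimately show ?thesis by blast
qed


section \<open>Separated sets\<close>

lemma seq_dist_ge:
  assumes "x k \<noteq> y k"
  shows "(1 / 2) ^ nat \<bar>k\<bar> \<le> seq_dist x y"
proof -
  have "infsum (\<lambda>k. (1 / 2 :: real) ^ nat \<bar>k\<bar>) {k} \<le> seq_dist x y"
    unfolding seq_dist_def using assms
    by (intro infsum_mono_neutral summable_seq_dist) auto
  then show ?thesis by simp
qed

text \<open>A single disagreement at distance at most \<open>W\<close> from 0 already costs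
  \<open>(1 / 2) ^ W\<close>, so any orbit point closer than that agrees on the whole
  window.\<close>

lemma orbit_closure_window:
  assumes "x \<in> orbit_closure \<omega>"
  shows "\<exists>a. \<forall>j. \<bar>j\<bar> \<le> int W \<longrightarrow> x j = \<omega> (a + j)"
proof -
  interpret Metric_space full_shift seq_dist by (rule Metric_space_full_shift)
  have "(1 / 2 :: real) ^ W > 0" by simp
  moreover have "\<forall>r>0. \<exists>a. seq_dist x (shift_pow a \<omega>) < r"
    using assms unfolding orbit_closure_def metric_closure_of by force
  ultimately obtain a where a: "seq_dist x (shift_pow a \<omega>) < (1 / 2) ^ W"
    by blast
  have "x j = \<omega> (a + j)" if "\<bar>j\<bar> \<le> int W" for j
  proof (rule ccontr)
    assume "x j \<noteq> \<omega> (a + j)"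
    then have "(1 / 2) ^ nat \<bar>j\<bar> \<le> seq_dist x (shift_pow a \<omega>)"
      by (intro seq_dist_ge) (simp add: shift_pow_def add.commute)
    moreover have "(1 / 2 :: real) ^ W \<le> (1 / 2) ^ nat \<bar>j\<bar>"
      using that by (intro power_decreasing) auto
    ultimately show False using a by simp
  qed
  then show ?thesis by blast
qed

lemma in_orbit_closure:
  assumes "\<omega> \<in> full_shift"
  shows "\<omega> \<in> orbit_closure \<omega>"
proof -
  interpret Metric_space full_shift seq_dist by (rule Metric_space_full_shift)
  have "range (\<lambda>k. shift_pow k \<omega>) \<subseteq> topspace mtopology"
    unfolding topspace_mtopology using assms by (simp add: full_shift_def shift_pow_def Pi_iff image_subset_iff)
  moreover have "\<omega> \<in> range (\<lambda>k. shift_pow k \<omega>)"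
    by (rule range_eqI[of _ _ 0]) (simp add: shift_pow_0)
  ultimately show ?thesis
    unfolding orbit_closure_def using closure_of_subset by blast
qed

text \<open>The weights outside a large central window sum to less than \<open>\<eta>\<close>, and
  each weight inside is at most 1.\<close>

lemma seq_dist_truncate:
  assumes "\<eta> > 0"
  shows "\<exists>M. \<forall>x y. seq_dist x y \<le> real (card {k \<in> {- int M..int M}. x k \<noteq> y k}) + \<eta>"
proof -
  let ?f = "\<lambda>k::int. (1 / 2 :: real) ^ nat \<bar>k\<bar>"
  have "(?f has_sum infsum ?f UNIV) UNIV"
    by (intro has_sum_infsum summable_seq_dist)
  then have "\<forall>\<^sub>F F in finite_subsets_at_top UNIV. dist (sum ?f F) (infsum ?f UNIV) < \<eta>"
    unfolding has_sum_def using assms by (rule tendstoD)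
  then obtain F where F: "finite F" "\<And>K. finite K \<Longrightarrow> F \<subseteq> K \<Longrightarrow> dist (sum ?f K) (infsum ?f UNIV) < \<eta>"
    unfolding eventually_finite_subsets_at_top by auto
  define M where "M = nat (Max (insert 0 (abs ` F)))"
  define K where "K = {- int M..int M}"
  have "F \<subseteq> K"
  proof
    fix j assume "j \<in> F"
    then have "\<bar>j\<bar> \<le> Max (insert 0 (abs ` F))"
      using F(1) by (intro Max_ge) auto
    then show "j \<in> K"
      by (auto simp: K_def M_def)
  qed
  then have K: "dist (sum ?f K) (infsum ?f UNIV) < \<eta>"
    by (intro F(2)) (simp_all add: K_def)
  have "infsum ?f UNIV = infsum ?f (K \<union> - K)"
    by simp
  also have "\<dots> = infsum ?f K + infsum ?f (- K)"
    by (rule infsum_Un_disjoint) (auto intro: summable_seq_dist)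
  also have "infsum ?f K = sum ?f K"
    by (simp add: K_def)
  finally have tail: "infsum ?f (- K) < \<eta>"
    using K by (simp add: dist_real_def)
  have "seq_dist x y \<le> real (card {k \<in> K. x k \<noteq> y k}) + \<eta>" for x y
  proof -
    have fin: "finite {k \<in> K. x k \<noteq> y k}"
      by (rule finite_subset[of _ K]) (auto simp: K_def)
    have "seq_dist x y \<le> infsum ?f ({k \<in> K. x k \<noteq> y k} \<union> - K)"
      unfolding seq_dist_def by (intro infsum_mono_neutral summable_seq_dist) auto
    also have "\<dots> = infsum ?f {k \<in> K. x k \<noteq> y k} + infsum ?f (- K)"
      by (rule infsum_Un_disjoint) (auto intro: summable_seq_dist)
    also have "infsum ?f {k \<in> K. x k \<noteq> y k} = sum ?f {k \<in> K. x k \<noteq> y k}"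
      using fin by simp
    also have "\<dots> \<le> of_nat (card {k \<in> K. x k \<noteq> y k}) * 1"
      by (rule sum_bounded_above) (simp add: power_le_one)
    finally show ?thesis using tail by simp
  qed
  then show ?thesis unfolding K_def by blast
qed

text \<open>Double counting: a disagreement in \<open>[- M, n + M)\<close> is seen at most once from
  each of the \<open>2 * M + 1\<close> offsets \<open>k\<close>.\<close>

lemma mean_dist_le:
  assumes "n \<ge> 1"
    and trunc: "\<And>x y. seq_dist x y \<le> real (card {k \<in> {- int M..int M}. x k \<noteq> y k}) + \<eta>"
  shows "mean_dist seq_dist shift n x y \<le>
    (2 * real M + 1) / real n * real (card {t. t < n + 2 * M \<and> x (int t - int M) \<noteq> y (int t - int M)}) + \<eta>"
proof -
  define C where "C = card {t. t < n + 2 * M \<and> x (int t - int M) \<noteq> y (int t - int M)}"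
  define d where "d i k = (of_bool (x (k + int i) \<noteq> y (k + int i)) :: nat)" for i :: nat and k
  have C: "(\<Sum>i<n. d i k) \<le> C" if "k \<in> {- int M..int M}" for k
  proof -
    have "(\<Sum>i<n. d i k) = card {i \<in> {..<n}. x (k + int i) \<noteq> y (k + int i)}"
      by (simp add: d_def sum_of_bool_eq Int_def)
    also have "\<dots> \<le> C"
      unfolding C_def
      by (rule card_inj_on_le[of "\<lambda>i. nat (k + int M) + i"]) (use that in \<open>auto simp: inj_on_def\<close>)
    finally show ?thesis .
  qed
  have "(\<Sum>i<n. card {k \<in> {- int M..int M}. x (k + int i) \<noteq> y (k + int i)}) =
      (\<Sum>i<n. \<Sum>k\<in>{- int M..int M}. d i k)"
    by (simp add: d_def sum_of_bool_eq Int_def)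
  also have "\<dots> = (\<Sum>k\<in>{- int M..int M}. \<Sum>i<n. d i k)"
    by (rule sum.swap)
  also have "\<dots> \<le> of_nat (card {- int M..int M}) * C"
    by (intro sum_bounded_above C)
  also have "card {- int M..int M} = 2 * M + 1"
    by simp
  finally have le: "(\<Sum>i<n. card {k \<in> {- int M..int M}. x (k + int i) \<noteq> y (k + int i)}) \<le> (2 * M + 1) * C"
    by simp
  have "(\<Sum>i<n. seq_dist ((shift ^^ i) x) ((shift ^^ i) y)) \<le>
      (\<Sum>i<n. real (card {k \<in> {- int M..int M}. x (k + int i) \<noteq> y (k + int i)}) + \<eta>)"
    unfolding shift_pow_of_nat[symmetric]
    by (intro sum_mono order_trans[OF trunc]) (simp add: shift_pow_def)
  also have "\<dots> = real (\<Sum>i<n. card {k \<in> {- int M..int M}. x (k + int i) \<noteq> y (k + int i)}) + real n * \<eta>"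
    by (simp add: sum.distrib)
  also have "\<dots> \<le> real ((2 * M + 1) * C) + real n * \<eta>"
    using le by (simp only: of_nat_le_iff add_le_cancel_right)
  finally show ?thesis
    using assms(1) unfolding mean_dist_def C_def[symmetric] by (simp add: field_simps)
qed

text \<open>Points whose windows carry the same label have mean distance below
  \<open>\<delta>\<close>, so a separated set injects into the label set, whose size does not depend
  on \<open>n\<close>.\<close>

lemma oxtoby_sep_number_bounded:
  assumes "\<delta> > 0"
  shows "\<exists>C. \<forall>n\<ge>1. sep_number (orbit_closure oxtoby) seq_dist shift n \<delta> \<le> enat C"
proof -
  obtain M where M: "\<And>x y. seq_dist x y \<le> real (card {k \<in> {- int M..int M}. x k \<noteq> y k}) + \<delta> / 2"
    using seq_dist_truncate[of "\<delta> / 2"] assms by auto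
  \<comment> \<open>One factor \<open>2 * M + 1\<close> comes from the double counting, the other
    from \<open>n + 2 * M \<le> (2 * M + 1) * n\<close>. The total is
    \<open>\<delta> / 4 + \<delta> / 2 < \<delta>\<close>.\<close>
  define \<epsilon> where "\<epsilon> = \<delta> / (4 * (2 * real M + 1) ^ 2)"
  have "\<epsilon> > 0" using assms by (simp add: \<epsilon>_def)
  obtain L :: "(int \<times> nat list) set" where "finite L" and L: "\<And>N. N \<ge> 1 \<Longrightarrow>
      \<exists>\<Phi>. range \<Phi> \<subseteq> L \<and> (\<forall>a b. \<Phi> a = \<Phi> b \<longrightarrow>
        real (card {t. t < N \<and> oxtoby (a + int t) \<noteq> oxtoby (b + int t)}) \<le> \<epsilon> * real N)"
    using oxtoby_finite_labels[OF \<open>\<epsilon> > 0\<close>] by (elim exE conjE) simp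
  have "sep_number (orbit_closure oxtoby) seq_dist shift n \<delta> \<le> enat (card L)" if n: "n \<ge> 1" for n
  proof -
    let ?N = "n + 2 * M"
    obtain \<Phi> where \<Phi>: "range \<Phi> \<subseteq> L" "\<And>a b. \<Phi> a = \<Phi> b \<Longrightarrow>
        real (card {t. t < ?N \<and> oxtoby (a + int t) \<noteq> oxtoby (b + int t)}) \<le> \<epsilon> * real ?N"
    proof -
      have "?N \<ge> 1" using n by simp
      from L[OF this] show thesis using that by (elim exE conjE) simp
    qed
    have "\<forall>x. \<exists>a. x \<in> orbit_closure oxtoby \<longrightarrow> (\<forall>t<?N. x (int t - int M) = oxtoby (a + int t))"
    proof (intro allI)
      fix x
      show "\<exists>a. x \<in> orbit_closure oxtoby \<longrightarrow> (\<forall>t<?N. x (int t - int M) = oxtoby (a + int t))"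
      proof (cases "x \<in> orbit_closure oxtoby")
        case True
        obtain a where a: "\<And>j. \<bar>j\<bar> \<le> int (n + M) \<Longrightarrow> x j = oxtoby (a + j)"
          using orbit_closure_window[OF True, of "n + M"] by blast
        \<comment> \<open>The window of \<open>x\<close> starts at \<open>- M\<close>, so its copy
          in \<open>oxtoby\<close> starts at \<open>a - M\<close>.\<close>
        have "\<forall>t<?N. x (int t - int M) = oxtoby ((a - int M) + int t)"
          using a by (simp add: algebra_simps)
        then show ?thesis by blast
      qed simp
    qed
    then obtain start where start: "\<And>x t. x \<in> orbit_closure oxtoby \<Longrightarrow> t < ?N \<Longrightarrow>
        x (int t - int M) = oxtoby (start x + int t)"
      by metis
    have close: "mean_dist seq_dist shift n x y < \<delta>"
      if xy: "x \<in> orbit_closure oxtoby" "y \<in> orbit_closure oxtoby" and eq: "\<Phi> (start x) = \<Phi> (start y)" for x y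
    proof -
      have "{t. t < ?N \<and> x (int t - int M) \<noteq> y (int t - int M)} =
          {t. t < ?N \<and> oxtoby (start x + int t) \<noteq> oxtoby (start y + int t)}"
        using start[OF xy(1)] start[OF xy(2)] by auto
      then have "real (card {t. t < ?N \<and> x (int t - int M) \<noteq> y (int t - int M)}) \<le> \<epsilon> * real ?N"
        using \<Phi>(2)[OF eq] by simp
      also have "\<dots> \<le> \<epsilon> * ((2 * real M + 1) * real n)"
      proof (intro mult_left_mono)
        have "2 * M * 1 \<le> 2 * M * n" using n by (intro mult_le_mono2)
        then have "?N \<le> (2 * M + 1) * n" by simp
        then have "real ?N \<le> real ((2 * M + 1) * n)" by (simp only: of_nat_le_iff)
        then show "real ?N \<le> (2 * real M + 1) * real n"
          by (simp only: of_nat_mult of_nat_add of_nat_numeral of_nat_1)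
      qed (use \<open>\<epsilon> > 0\<close> in simp)
      finally have "(2 * real M + 1) / real n *
          real (card {t. t < ?N \<and> x (int t - int M) \<noteq> y (int t - int M)}) \<le>
          (2 * real M + 1) / real n * (\<epsilon> * ((2 * real M + 1) * real n))"
        by (intro mult_left_mono) auto
      also have "\<dots> = \<epsilon> * (2 * real M + 1) ^ 2"
        using n by (simp add: power2_eq_square)
      also have "\<dots> = \<delta> / 4"
      proof -
        have "2 * real M + 1 > 0" by simp
        then show ?thesis unfolding \<epsilon>_def by simp
      qed
      finally show ?thesis
        using mean_dist_le[OF n M, of x y] assms by linarith
    qed
    show ?thesis
      unfolding sep_number_def
    proof (rule SUP_least)
      fix S
      assume S: "S \<in> {S. S \<subseteq> orbit_closure oxtoby \<and> finite S \<and>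
        (\<forall>x\<in>S. \<forall>y\<in>S. x \<noteq> y \<longrightarrow> mean_dist seq_dist shift n x y \<ge> \<delta>)}"
      have "card S \<le> card L"
      proof (rule card_inj_on_le[of "\<lambda>x. \<Phi> (start x)"])
        show "inj_on (\<lambda>x. \<Phi> (start x)) S"
        proof (rule inj_onI, rule ccontr)
          fix x y assume xy: "x \<in> S" "y \<in> S" "\<Phi> (start x) = \<Phi> (start y)" "x \<noteq> y"
          have "x \<in> orbit_closure oxtoby" "y \<in> orbit_closure oxtoby"
            using S xy(1,2) by auto
          then have "mean_dist seq_dist shift n x y < \<delta>"
            using xy(3) by (rule close)
          moreover have "mean_dist seq_dist shift n x y \<ge> \<delta>"
            using S xy(1,2,4) by simp
          ultimately show False by simp
        qed
      qed (use \<Phi>(1) \<open>finite L\<close> in auto)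
      then show "enat (card S) \<le> enat (card L)" by simp
    qed
  qed
  then show ?thesis by blast
qed

section \<open>From bounded separation numbers to entropy zero\<close>

lemma sep_number_ge_1:
  assumes "x \<in> X"
  shows "1 \<le> sep_number X d f n \<delta>"
proof -
  have "enat (card {x}) \<le> sep_number X d f n \<delta>"
    unfolding sep_number_def by (rule SUP_upper) (use assms in auto)
  then show ?thesis by (simp add: one_enat_def)
qed

text \<open>For each \<open>\<delta>\<close> the numerator stays between 0 and \<open>ln C\<close>
  while \<open>ln n\<close> tends to infinity. The point \<open>x\<close> keeps the separation
  numbers at least 1, so the logarithms are nonnegative.\<close>

lemma has_mod_power_entropy_0:
  assumes "x \<in> X"
    and bounded: "\<And>\<delta>. \<delta> > 0 \<Longrightarrow> \<exists>C. \<forall>n\<ge>1. sep_number X d f n \<delta> \<le> enat C"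
  shows "has_mod_power_entropy X d f 0"
  unfolding has_mod_power_entropy_def
proof (intro exI[of _ "\<lambda>_. 0"] conjI allI impI)
  fix \<delta> :: real assume "\<delta> > 0"
  then obtain C where C: "\<And>n. n \<ge> 1 \<Longrightarrow> sep_number X d f n \<delta> \<le> enat C"
    using bounded by blast
  have bounds: "0 \<le> ln_enat (sep_number X d f n \<delta>) / ereal (ln (real n)) \<and>
      ln_enat (sep_number X d f n \<delta>) / ereal (ln (real n)) \<le> ereal (ln (real C) / ln (real n))"
    if n: "n \<ge> 2" for n
  proof -
    obtain c where c: "sep_number X d f n \<delta> = enat c"
      using C[of n] n by (cases "sep_number X d f n \<delta>") auto
    have "1 \<le> c" "c \<le> C"
      using sep_number_ge_1[OF assms(1), of d f n \<delta>] C[of n] n by (simp_all add: c one_enat_def)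
    then have "0 \<le> ln (real c)" "ln (real c) \<le> ln (real C)"
      by simp_all
    moreover have "ln (real n) > 0"
      using n by simp
    ultimately show ?thesis
      by (simp add: c ln_enat_def divide_right_mono)
  qed
  have "(\<lambda>n. ln (real C) / ln (real n)) \<longlonglongrightarrow> 0"
    by (intro tendsto_divide_0[OF tendsto_const] filterlim_at_top_imp_at_infinity
        filterlim_compose[OF ln_at_top] filterlim_real_sequentially)
  then have upper: "(\<lambda>n. ereal (ln (real C) / ln (real n))) \<longlonglongrightarrow> 0"
    by (simp add: zero_ereal_def)
  show "(\<lambda>n. ln_enat (sep_number X d f n \<delta>) / ereal (ln (real n))) \<longlonglongrightarrow> 0"
  proof (rule tendsto_sandwich[OF _ _ tendsto_const upper])
    show "\<forall>\<^sub>F n in sequentially. 0 \<le> ln_enat (sep_number X d f n \<delta>) / ereal (ln (real n))"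
      "\<forall>\<^sub>F n in sequentially. ln_enat (sep_number X d f n \<delta>) / ereal (ln (real n)) \<le>
        ereal (ln (real C) / ln (real n))"
      using bounds by (auto intro: eventually_sequentiallyI[of 2])
  qed
qed simp

theorem theorem7p1:
  shows "\<exists>\<omega>. irregular_toeplitz \<omega> \<and>
           (\<forall>\<delta>>0. (SUP n\<in>{1..}. sep_number (orbit_closure \<omega>) seq_dist shift n \<delta>) < \<infinity>) \<and>
           has_mod_power_entropy (orbit_closure \<omega>) seq_dist shift 0"
proof (intro exI[of _ oxtoby] conjI allI impI)
  show "irregular_toeplitz oxtoby"
    by (rule irregular_toeplitz_oxtoby)
  show "has_mod_power_entropy (orbit_closure oxtoby) seq_dist shift 0"
    by (rule has_mod_power_entropy_0[OF in_orbit_closure[OF oxtoby_full_shift] oxtoby_sep_number_bounded])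
  fix \<delta> :: real assume "\<delta> > 0"
  then obtain C where "\<And>n. n \<ge> 1 \<Longrightarrow> sep_number (orbit_closure oxtoby) seq_dist shift n \<delta> \<le> enat C"
    using oxtoby_sep_number_bounded by blast
  then have "(SUP n\<in>{1..}. sep_number (orbit_closure oxtoby) seq_dist shift n \<delta>) \<le> enat C"
    by (intro SUP_least) auto
  then show "(SUP n\<in>{1..}. sep_number (orbit_closure oxtoby) seq_dist shift n \<delta>) < \<infinity>"
    using enat_ord_simps(4) le_less_trans by blast
qed

end
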